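(* Fix $h\in\mathbb C^\times$, a half-step-invariant set $U\subseteq\mathbb C$, an admissible map $X:U\to\mathbb C$, and the associated operators $D,S$ on $\mathcal P$. Fix $\phi\in\mathcal P_2$ and $\psi\in\mathcal P_1$, not both zero. Let $N\in\mathbb N$. The set $\mathfrak M_N$ consists precisely of the normalised (that is, $\mu_0=1$) finite moment vectors $\boldsymbol\mu=(\mu_0,\dots,\mu_{2N+2})\in\mathbb C^{2N+3}$ which satisfy the functional equation $\mathbf D(\phi\mathbf u)=\mathbf S(\psi\mathbf u)$ when it is tested on $\mathcal P_{2N+1}$, i.e. for which $$\mathscr L_{\boldsymbol\mu}(\phi\,Dp+\psi\,Sp)=0\quad\text{for every }p\in\mathcal P_{2N+1}.$$ A vector $\boldsymbol\mu\in\mathfrak M_N$ admits a monic orthogonal polynomial sequence $P_0,P_1,\dots,P_{N+1}$ with respect to $\mathscr L_{\boldsymbol\mu}$ if and only if $$\Delta_m(\boldsymbol\mu)\neq0,\qquad m=0,1,\dots,N+1.$$ When these conditions hold, the sequence is unique. With $\Delta_{-1}=1$ and $\Delta_m=\Delta_m(\boldsymbol\mu)$, its squared norms are $$\mathscr L_{\boldsymbol\mu}(P_m^2)=\frac{\Delta_m}{\Delta_{m-1}},\qquad 0\le m\le N+1,$$ and its subdiagonal recurrence coefficients are $$C_m=\frac{\Delta_m\Delta_{m-2}}{\Delta_{m-1}^2},\qquad 1\le m\le N+1.$$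
   Context: $\mathbb N=\{0,1,2,\dots\}$, $\mathbb C^\times=\mathbb C\setminus\{0\}$. Fix $h\in\mathbb C^\times$. A non-empty set $U\subseteq\mathbb C$ is half-step-invariant if $U\pm\frac h2\subseteq U$. For $X:U\to\mathbb C$ put $Y(s)=X(s+\frac h2)$, $Z(s)=X(s-\frac h2)$. $X$ is parametrising if $Y-Z$ vanishes nowhere on $U$; it is admissible if moreover $X(U)$ is infinite and for every complex polynomial $p$ of degree $\ge1$ there is a polynomial $Q$ with $\deg Q\le\deg p-1$ and $\frac{p(Y)-p(Z)}{Y-Z}=Q(X)$ throughout $U$. $\mathcal P$ is the space of complex polynomials in $x$, $\mathcal P_n$ those of degree at most $n$. For admissible $X$, $D,S:\mathcal P\to\mathcal P$ are the linear maps for which $Dp$, $Sp$ are the unique polynomials with $$(Dp)(X)=\frac{p(Y)-p(Z)}{Y-Z},\qquad (Sp)(X)=\frac{p(Y)+p(Z)}2$$ throughout $U$ (they exist and are unique). For a linear functional $\mathbf u$ on $\mathcal P$, $\langle p_0\mathbf u,p\rangle=\langle\mathbf u,p_0p\rangle$, $\langle\mathbf D\mathbf u,p\rangle=-\langle\mathbf u,Dp\rangle$, $\langle\mathbf S\mathbf u,p\rangle=\langle\mathbf u,Sp\rangle$. For $n\in\mathbb N$ write $\phi(x)D(x^n)+\psi(x)S(x^n)=\sum_{k=0}^{n+1}\vartheta_{n,k}x^k$, with $\vartheta_{n,k}=0$ for $k>n+1$. Let $A_N=(\vartheta_{n,k})_{0\le n\le 2N+1,\,0\le k\le 2N+2}$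 and $$\mathfrak M_N=\{\boldsymbol\mu=(\mu_0,\dots,\mu_{2N+2})\in\mathbb C^{2N+3}:\ \mu_0=1,\ A_N\boldsymbol\mu=0\}.$$ For $0\le m\le N+1$, $\Delta_m(\boldsymbol\mu)=\det(\mu_{i+j})_{i,j=0}^m$. The vector $\boldsymbol\mu$ defines a linear functional $\mathscr L_{\boldsymbol\mu}$ on $\mathcal P_{2N+2}$ by $\mathscr L_{\boldsymbol\mu}(x^k)=\mu_k$. A sequence $P_0,\dots,P_{N+1}$ with $\deg P_n=n$ is orthogonal with respect to $\mathscr L_{\boldsymbol\mu}$ if $\mathscr L_{\boldsymbol\mu}(P_nP_m)=0$ for $0\le m<n\le N+1$ and $\mathscr L_{\boldsymbol\mu}(P_n^2)\ne0$ for $0\le n\le N+1$. The subdiagonal recurrence coefficients are $C_m=\mathscr L_{\boldsymbol\mu}(P_m^2)/\mathscr L_{\boldsymbol\mu}(P_{m-1}^2)$, which for $1\le m\le N$ is the coefficient in $P_{m+1}(x)=(x-B_m)P_m(x)-C_mP_{m-1}(x)$ and for $m=N+1$ is the terminal norm coefficient. *)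

theory Defs
  imports Complex_Main "HOL-Computational_Algebra.Polynomial" "Jordan_Normal_Form.Determinant"
begin

definition half_step_invariant :: "complex \<Rightarrow> complex set \<Rightarrow> bool" where
  "half_step_invariant h U \<longleftrightarrow>
     U \<noteq> {} \<and> (\<forall>s\<in>U. s + h / 2 \<in> U \<and> s - h / 2 \<in> U)"

text \<open>
  A map \<open>X : U \<rightarrow> \<complex>\<close> is represented by a total function of which only the values on \<open>U\<close>
  are used; for half-step-invariant \<open>U\<close> this covers the two shifts as well.
\<close>

definition fwd :: "complex \<Rightarrow> (complex \<Rightarrow> complex) \<Rightarrow> complex \<Rightarrow> complex" where
  "fwd h X s = X (s + h / 2)"

definition bwd :: "complex \<Rightarrow> (complex \<Rightarrow> complex) \<Rightarrow> complex \<Rightarrow> complex" where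
  "bwd h X s = X (s - h / 2)"

definition parametrising :: "complex \<Rightarrow> complex set \<Rightarrow> (complex \<Rightarrow> complex) \<Rightarrow> bool" where
  "parametrising h U X \<longleftrightarrow> (\<forall>s\<in>U. fwd h X s - bwd h X s \<noteq> 0)"

definition admissible :: "complex \<Rightarrow> complex set \<Rightarrow> (complex \<Rightarrow> complex) \<Rightarrow> bool" where
  "admissible h U X \<longleftrightarrow>
     parametrising h U X \<and> infinite (X ` U) \<and>
     (\<forall>p :: complex poly. degree p \<ge> 1 \<longrightarrow>
        (\<exists>Q. degree Q \<le> degree p - 1 \<and>
           (\<forall>s\<in>U. (poly p (fwd h X s) - poly p (bwd h X s)) / (fwd h X s - bwd h X s)
                    = poly Q (X s))))"

definition diff_op :: "complex \<Rightarrow> complex set \<Rightarrow> (complex \<Rightarrow> complex) \<Rightarrow> complex poly \<Rightarrow> complex poly" where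
  "diff_op h U X p = (THE q. \<forall>s\<in>U. poly q (X s) =
     (poly p (fwd h X s) - poly p (bwd h X s)) / (fwd h X s - bwd h X s))"

definition avg_op :: "complex \<Rightarrow> complex set \<Rightarrow> (complex \<Rightarrow> complex) \<Rightarrow> complex poly \<Rightarrow> complex poly" where
  "avg_op h U X p = (THE q. \<forall>s\<in>U. poly q (X s) =
     (poly p (fwd h X s) + poly p (bwd h X s)) / 2)"

text \<open>For admissible \<open>X\<close> both descriptions determine a polynomial.\<close>

lemma poly_eq_on_lattice:
  fixes q r :: "complex poly"
  assumes "infinite (X ` U)" "\<forall>s\<in>U. poly q (X s) = poly r (X s)"
  shows "q = r"
proof (rule ccontr)
  assume "q \<noteq> r"
  then have "finite {x. poly (q - r) x = 0}"
    by (intro poly_roots_finite) simp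
  moreover have "X ` U \<subseteq> {x. poly (q - r) x = 0}"
    using assms(2) by auto
  ultimately show False
    using assms(1) finite_subset by blast
qed

lemma diff_op_exists:
  assumes "admissible h U X"
  shows "\<exists>q. \<forall>s\<in>U. poly q (X s) =
     (poly p (fwd h X s) - poly p (bwd h X s)) / (fwd h X s - bwd h X s)"
proof (cases "degree p \<ge> 1")
  case True
  then show ?thesis
    using assms unfolding admissible_def by metis
next
  case False
  then obtain c where "p = [:c:]"
    by (metis degree_eq_zeroE less_one not_less)
  then show ?thesis
    by (intro exI[of _ 0]) simp
qed

lemma poly_diff_op:
  assumes "admissible h U X" "s \<in> U"
  shows "poly (diff_op h U X p) (X s) =
     (poly p (fwd h X s) - poly p (bwd h X s)) / (fwd h X s - bwd h X s)"
proof -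
  let ?R = "\<lambda>q. \<forall>s\<in>U. poly q (X s) =
     (poly p (fwd h X s) - poly p (bwd h X s)) / (fwd h X s - bwd h X s)"
  obtain q where q: "?R q"
    using diff_op_exists[OF assms(1)] by blast
  have "r = q" if "?R r" for r
    by (rule poly_eq_on_lattice[where X = X and U = U])
       (use assms(1) q that in \<open>auto simp: admissible_def\<close>)
  then have "?R (THE q. ?R q)"
    by (intro theI[of ?R q]) (use q in blast)+
  then show ?thesis
    using assms(2) by (simp add: diff_op_def)
qed

lemma poly_avg_op:
  assumes "admissible h U X" "s \<in> U"
  shows "poly (avg_op h U X p) (X s) = (poly p (fwd h X s) + poly p (bwd h X s)) / 2"
proof -
  let ?R = "\<lambda>q. \<forall>s\<in>U. poly q (X s) = (poly p (fwd h X s) + poly p (bwd h X s)) / 2"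
  let ?D = "diff_op h U X"
  let ?q = "?D ([:0, 1:] * p) - smult (1 / 2) (?D [:0, 0, 1:]) * ?D p"
  have q: "?R ?q"
  proof
    fix s assume s: "s \<in> U"
    then have nz: "fwd h X s - bwd h X s \<noteq> 0"
      using assms(1) by (simp add: admissible_def parametrising_def)
    show "poly ?q (X s) = (poly p (fwd h X s) + poly p (bwd h X s)) / 2"
      using nz by (simp add: poly_diff_op[OF assms(1) s] divide_simps) (simp add: algebra_simps)
  qed
  have "r = ?q" if r: "?R r" for r
  proof (rule poly_eq_on_lattice)
    show "infinite (X ` U)"
      using assms(1) by (simp add: admissible_def)
    show "\<forall>s\<in>U. poly r (X s) = poly ?q (X s)"
      by (rule ballI, rule trans[OF bspec[OF r] bspec[OF q, symmetric]])
  qed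
  then have "?R (THE q. ?R q)"
    by (intro theI[of ?R ?q]) (use q in blast)+
  then show ?thesis
    using assms(2) by (simp add: avg_op_def)
qed

definition mult_fun ::
  "complex poly \<Rightarrow> (complex poly \<Rightarrow> complex) \<Rightarrow> complex poly \<Rightarrow> complex" where
  "mult_fun p0 u = (\<lambda>p. u (p0 * p))"

definition diff_fun ::
  "complex \<Rightarrow> complex set \<Rightarrow> (complex \<Rightarrow> complex) \<Rightarrow> (complex poly \<Rightarrow> complex) \<Rightarrow> complex poly \<Rightarrow> complex" where
  "diff_fun h U X u = (\<lambda>p. - u (diff_op h U X p))"

definition avg_fun ::
  "complex \<Rightarrow> complex set \<Rightarrow> (complex \<Rightarrow> complex) \<Rightarrow> (complex poly \<Rightarrow> complex) \<Rightarrow> complex poly \<Rightarrow> complex" where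
  "avg_fun h U X u = (\<lambda>p. u (avg_op h U X p))"

definition theta ::
  "complex \<Rightarrow> complex set \<Rightarrow> (complex \<Rightarrow> complex) \<Rightarrow> complex poly \<Rightarrow> complex poly \<Rightarrow> nat \<Rightarrow> nat \<Rightarrow> complex" where
  "theta h U X \<phi> \<psi> n k =
     coeff (\<phi> * diff_op h U X (monom 1 n) + \<psi> * avg_op h U X (monom 1 n)) k"

definition moment_matrix ::
  "complex \<Rightarrow> complex set \<Rightarrow> (complex \<Rightarrow> complex) \<Rightarrow> complex poly \<Rightarrow> complex poly \<Rightarrow> nat \<Rightarrow> complex mat" where
  "moment_matrix h U X \<phi> \<psi> N =
     mat (2 * N + 2) (2 * N + 3) (\<lambda>(n, k). theta h U X \<phi> \<psi> n k)"

definition moment_set ::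
  "complex \<Rightarrow> complex set \<Rightarrow> (complex \<Rightarrow> complex) \<Rightarrow> complex poly \<Rightarrow> complex poly \<Rightarrow> nat \<Rightarrow> complex vec set" where
  "moment_set h U X \<phi> \<psi> N =
     {\<mu> \<in> carrier_vec (2 * N + 3).
        \<mu> $ 0 = 1 \<and> moment_matrix h U X \<phi> \<psi> N *\<^sub>v \<mu> = 0\<^sub>v (2 * N + 2)}"

text \<open>
  The functional on \<open>\<P>\<^sub>2\<^sub>N\<^sub>+\<^sub>2\<close> with moments \<open>\<mu> \<in> \<complex>\<^sup>2\<^sup>N\<^sup>+\<^sup>3\<close>; as a total function it
  ignores coefficients of index \<open>\<ge> 2N + 3\<close>, so it is meaningful only up to degree \<open>2N + 2\<close>.
\<close>

definition moment_fun :: "complex vec \<Rightarrow> complex poly \<Rightarrow> complex" where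
  "moment_fun \<mu> p = (\<Sum>k<dim_vec \<mu>. coeff p k * \<mu> $ k)"

text \<open>The index is an integer to accommodate the convention \<open>\<Delta>\<^sub>-\<^sub>1 = 1\<close>.\<close>

definition hankel_det :: "complex vec \<Rightarrow> int \<Rightarrow> complex" where
  "hankel_det \<mu> m =
     (if m = -1 then 1 else det (mat (nat m + 1) (nat m + 1) (\<lambda>(i, j). \<mu> $ (i + j))))"

text \<open>A finite sequence \<open>P\<^sub>0, \<dots>, P\<^sub>M\<close> is given by the values at \<open>n \<le> M\<close> of a function on \<open>nat\<close>.\<close>

definition orthogonal_seq :: "(complex poly \<Rightarrow> complex) \<Rightarrow> nat \<Rightarrow> (nat \<Rightarrow> complex poly) \<Rightarrow> bool" where
  "orthogonal_seq L M P \<longleftrightarrow>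
     (\<forall>n\<le>M. P n \<noteq> 0 \<and> degree (P n) = n) \<and>
     (\<forall>n\<le>M. \<forall>m<n. L (P n * P m) = 0) \<and>
     (\<forall>n\<le>M. L (P n ^ 2) \<noteq> 0)"

definition monic_orthogonal_seq :: "(complex poly \<Rightarrow> complex) \<Rightarrow> nat \<Rightarrow> (nat \<Rightarrow> complex poly) \<Rightarrow> bool" where
  "monic_orthogonal_seq L M P \<longleftrightarrow>
     orthogonal_seq L M P \<and> (\<forall>n\<le>M. lead_coeff (P n) = 1)"

definition subdiag_coeff :: "(complex poly \<Rightarrow> complex) \<Rightarrow> (nat \<Rightarrow> complex poly) \<Rightarrow> nat \<Rightarrow> complex" where
  "subdiag_coeff L P m = L (P m ^ 2) / L (P (m - 1) ^ 2)"

end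

theory Submission
  imports Defs
begin

text \<open>
  The operators \<open>D\<close>, \<open>S\<close> and the moment functional are linear, so the functional equation need only
  be tested on monomials, where it reads off the rows of the moment matrix. For the orthogonal
  polynomials, let \<open>T\<close> be the unitriangular matrix of the coefficients of monic mutually orthogonal
  \<open>P\<^sub>0, \<dots>, P\<^sub>m\<close> and \<open>H\<close> the Hankel matrix of the moments. Then \<open>T H T\<^sup>t\<close> is diagonal with entries
  \<open>L(P\<^sub>i\<^sup>2)\<close>, whence \<open>\<Delta>\<^sub>m = \<Prod>\<^sub>i L(P\<^sub>i\<^sup>2)\<close>. This identity does not presuppose that the norms are nonzero,
  so it also drives the Gram--Schmidt construction in the converse direction.
\<close>

section \<open>Linear functionals on polynomials and their Hankel determinants\<close>

locale poly_functional =
  fixes L :: "complex poly \<Rightarrow> complex"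
  assumes add: "L (p + q) = L p + L q"
    and smult: "L (smult c p) = c * L p"
begin

lemma zero: "L 0 = 0"
  using smult[of 0 0] by simp

lemma diff: "L (p - q) = L p - L q"
  using add[of "p - q" q] by simp

lemma sum: "L (\<Sum>i\<in>A. f i) = (\<Sum>i\<in>A. L (f i))"
  by (induction A rule: infinite_finite_induct) (simp_all add: zero add)

text \<open>The bound \<open>n\<close> may exceed the degree of \<open>p\<close> plus one, so that
  all rows of an \<open>n\<close> by \<open>n\<close> matrix can share one summation range.\<close>

lemma mult_expand:
  assumes "degree p < n"
  shows "L (p * q) = (\<Sum>k<n. coeff p k * L (monom 1 k * q))"
proof -
  have "p = (\<Sum>k<n. smult (coeff p k) (monom 1 k))"
    by (rule poly_eqI) (use assms in \<open>auto simp: coeff_sum coeff_eq_0 if_distrib cong: if_cong\<close>)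
  then have "p * q = (\<Sum>k<n. smult (coeff p k) (monom 1 k * q))"
    by (metis (no_types, lifting) mult_smult_left sum.cong sum_distrib_right)
  then show ?thesis
    by (simp add: sum smult)
qed

text \<open>Indexing by the size of the matrix makes \<open>n = 0\<close> the empty determinant, in
  agreement with the convention that the Hankel determinant of index -1 is 1.\<close>

lemma det_hankel_eq_prod:
  assumes deg: "\<And>i. i < n \<Longrightarrow> degree (P i) = i"
    and monic: "\<And>i. i < n \<Longrightarrow> lead_coeff (P i) = 1"
    and orth: "\<And>i j. i < n \<Longrightarrow> j < i \<Longrightarrow> L (P i * P j) = 0"
  shows "det (mat n n (\<lambda>(i, j). L (monom 1 (i + j)))) = (\<Prod>i<n. L (P i ^ 2))"
proof -
  define T where "T = mat n n (\<lambda>(i, j). coeff (P i) j)"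
  define H where "H = mat n n (\<lambda>(i, j). L (monom 1 (i + j)))"
  have T: "T \<in> carrier_mat n n" and H: "H \<in> carrier_mat n n"
    by (simp_all add: T_def H_def)
  have orth': "L (P i * P j) = 0" if "i < n" "j < n" "i \<noteq> j" for i j
    using orth[of i j] orth[of j i] that by (cases "j < i") (auto simp: mult.commute)
  have T_ij: "T $$ (i, j) = coeff (P i) j" if "i < n" "j < n" for i j
    using that by (simp add: T_def)
  \<comment> \<open>Right multiplication by the transpose of \<open>T\<close> replaces the second
    monomial in each moment by \<open>P j\<close>; left multiplication by \<open>T\<close> then
    treats the first one likewise.\<close>
  have HT: "(H * T\<^sup>T) $$ (i, j) = L (monom 1 i * P j)" if "i < n" "j < n" for i j
  proof -
    have "L (monom 1 i * P j) = (\<Sum>k<n. coeff (P j) k * L (monom 1 k * monom 1 i))"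
      using mult_expand[of "P j" n "monom 1 i"] deg that by (simp add: mult.commute)
    then show ?thesis
      using that by (simp add: T_def H_def scalar_prod_def mult_monom ac_simps atLeast0LessThan)
  qed
  have THT: "T * (H * T\<^sup>T) = mat n n (\<lambda>(i, j). if i = j then L (P i ^ 2) else 0)"
  proof (rule eq_matI)
    fix i j
    assume "i < dim_row (mat n n (\<lambda>(i, j). if i = j then L (P i ^ 2) else 0))"
      and "j < dim_col (mat n n (\<lambda>(i, j). if i = j then L (P i ^ 2) else 0))"
    then have ij: "i < n" "j < n"
      by auto
    have "(T * (H * T\<^sup>T)) $$ (i, j) = (\<Sum>k<n. T $$ (i, k) * (H * T\<^sup>T) $$ (k, j))"
      using ij T H by (simp add: scalar_prod_def atLeast0LessThan)
    also have "\<dots> = (\<Sum>k<n. coeff (P i) k * L (monom 1 k * P j))"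
      using ij HT by (intro sum.cong) (simp_all add: T_ij)
    also have "\<dots> = L (P i * P j)"
      using mult_expand[of "P i" n "P j"] deg ij by simp
    finally show "(T * (H * T\<^sup>T)) $$ (i, j) =
        mat n n (\<lambda>(i, j). if i = j then L (P i ^ 2) else 0) $$ (i, j)"
      using ij orth' by (simp add: power2_eq_square)
  qed (simp_all add: T_def)
  \<comment> \<open>\<open>T\<close> is lower triangular because \<open>P i\<close> has no
    coefficient beyond index \<open>i\<close>; monicity puts 1 on the diagonal.\<close>
  have "det T = prod_list (diag_mat T)"
    by (rule det_lower_triangular[OF _ T]) (simp add: T_def deg coeff_eq_0)
  also have "diag_mat T = map (\<lambda>i. 1) [0..<n]"
    unfolding diag_mat_def using deg monic by (auto simp: T_def)
  finally have detT: "det T = 1"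
    by (simp add: map_replicate_const)
  have "det (T * (H * T\<^sup>T)) = det H"
    using T H detT det_transpose[OF T] by (simp add: det_mult[of _ n])
  moreover have "det (mat n n (\<lambda>(i, j). if i = j then L (P i ^ 2) else 0)) = (\<Prod>i<n. L (P i ^ 2))"
    by (subst det_lower_triangular[where n = n])
       (auto simp: diag_mat_def prod.list_conv_set_nth atLeast0LessThan)
  ultimately show ?thesis
    unfolding THT by (simp add: H_def)
qed

lemma monic_orthogonal_seq_det:
  assumes "monic_orthogonal_seq L M P" "n \<le> Suc M"
  shows "det (mat n n (\<lambda>(i, j). L (monom 1 (i + j)))) = (\<Prod>i<n. L (P i ^ 2))"
  using assms by (intro det_hankel_eq_prod) (auto simp: monic_orthogonal_seq_def orthogonal_seq_def)

section \<open>Orthogonality to lower degrees, and uniqueness\<close>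

text \<open>Polynomials of degree below \<open>k\<close> are combinations of the \<open>P j\<close>
  with \<open>j < k\<close>, hence are annihilated. By monicity the \<open>x^k\<close> term of
  \<open>q\<close> can be traded for a multiple of \<open>P k\<close>, which alone
  contributes.\<close>

lemma orthogonal_mult:
  assumes "monic_orthogonal_seq L M P" "k \<le> M" "degree q \<le> k"
  shows "L (P k * q) = coeff q k * L (P k ^ 2)"
proof -
  have lower: "L (P k * r) = 0" if "degree r < k" for r
    using that
  proof (induction "degree r" arbitrary: r rule: less_induct)
    case less
    let ?d = "degree r"
    let ?r = "r - smult (coeff r ?d) (P ?d)"
    have P: "degree (P ?d) = ?d" "lead_coeff (P ?d) = 1" "L (P k * P ?d) = 0"
      using assms less.prems by (auto simp: monic_orthogonal_seq_def orthogonal_seq_def)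
    \<comment> \<open>Subtracting the multiple of \<open>P ?d\<close> cancels the leading term. A
      zero remainder is treated apart, since for constant \<open>r\<close> the degree cannot drop
      further.\<close>
    have "L (P k * ?r) = 0"
    proof (cases "?r = 0")
      case True
      then show ?thesis by (simp add: zero)
    next
      case False
      have "degree ?r \<le> ?d"
        by (intro degree_diff_le) (simp_all add: P)
      moreover have "coeff ?r ?d = 0"
        using P by simp
      ultimately have "degree ?r < ?d"
        using False by (metis le_neq_implies_less leading_coeff_0_iff)
      then show ?thesis
        using less by simp
    qed
    then show ?case
      by (simp add: right_diff_distrib diff smult P)
  qed
  let ?r = "q - smult (coeff q k) (P k)"
  have P: "degree (P k) = k" "lead_coeff (P k) = 1"
    using assms by (auto simp: monic_orthogonal_seq_def orthogonal_seq_def)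
  have "L (P k * ?r) = 0"
  proof (cases "?r = 0")
    case True
    then show ?thesis by (simp add: zero)
  next
    case False
    have "degree ?r \<le> k"
      using assms(3) by (intro degree_diff_le) (simp_all add: P)
    moreover have "coeff ?r k = 0"
      using P by simp
    ultimately have "degree ?r < k"
      using False by (metis le_neq_implies_less leading_coeff_0_iff)
    then show ?thesis
      by (rule lower)
  qed
  then show ?thesis
    by (simp add: right_diff_distrib diff smult power2_eq_square)
qed

text \<open>Pairing \<open>q\<close> with \<open>P (degree q)\<close> gives the leading coefficient
  of \<open>q\<close> times a nonzero squared norm. Uniqueness and the recurrence both follow by
  applying this to a difference.\<close>

lemma orthogonal_nondegenerate:
  assumes "monic_orthogonal_seq L M P" "degree q \<le> M"
    and "\<And>k. k \<le> degree q \<Longrightarrow> L (P k * q) = 0"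
  shows "q = 0"
proof -
  have "coeff q (degree q) * L (P (degree q) ^ 2) = 0"
    using orthogonal_mult[OF assms(1,2), of q] assms(3) by simp
  moreover have "L (P (degree q) ^ 2) \<noteq> 0"
    using assms by (auto simp: monic_orthogonal_seq_def orthogonal_seq_def)
  ultimately show ?thesis
    by simp
qed

lemma monic_orthogonal_seq_unique:
  assumes P: "monic_orthogonal_seq L M P" and Q: "monic_orthogonal_seq L M Q" and n: "n \<le> M"
  shows "P n = Q n"
proof -
  have deg: "degree (P k) = k" "degree (Q k) = k" if "k \<le> M" for k
    using P Q that by (auto simp: monic_orthogonal_seq_def orthogonal_seq_def)
  have le: "degree (P n - Q n) \<le> n"
    using n by (intro degree_diff_le) (simp_all add: deg)
  have lc: "coeff (P n - Q n) n = 0"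
    using P Q n deg[OF n] by (metis coeff_diff diff_self monic_orthogonal_seq_def)
  have "P n - Q n = 0"
  proof (rule orthogonal_nondegenerate[OF P])
    show "degree (P n - Q n) \<le> M"
      using le n by simp
    fix k assume k: "k \<le> degree (P n - Q n)"
    \<comment> \<open>Only the bound \<open>n\<close> on the degree of the difference is recorded,
      so \<open>k = n\<close> remains possible; there the cancelled leading coefficients give
      0.\<close>
    show "L (P k * (P n - Q n)) = 0"
    proof (cases "k = n")
      case True
      then show ?thesis
        using orthogonal_mult[OF P n le] lc by simp
    next
      case False
      then have kn: "k < n"
        using k le by simp
      then have "L (P n * P k) = 0" "L (Q n * P k) = 0"
        using orthogonal_mult[OF P n, of "P k"] orthogonal_mult[OF Q n, of "P k"] n
        by (simp_all add: deg coeff_eq_0)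
      then show ?thesis
        by (simp add: right_diff_distrib diff mult.commute)
    qed
  qed
  then show ?thesis
    by simp
qed

section \<open>The three-term recurrence\<close>

lemma monic_orthogonal_seq_recurrence:
  assumes P: "monic_orthogonal_seq L M P" and m: "1 \<le> m" "m < M"
  shows "P (m + 1) = [:- (L (P m * ([:0, 1:] * P m)) / L (P m ^ 2)), 1:] * P m
           - smult (subdiag_coeff L P m) (P (m - 1))"
proof -
  let ?x = "[:0, 1:] :: complex poly"
  define b where "b = L (P m * (?x * P m)) / L (P m ^ 2)"
  define c where "c = subdiag_coeff L P m"
  \<comment> \<open>\<open>R\<close> is the defect of the recurrence. Its terms of degree
    \<open>m + 1\<close> cancel, so it suffices to show that it is orthogonal to \<open>P 0\<close>,
    ..., \<open>P m\<close>.\<close>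
  define R where "R = P (m + 1) - ?x * P m + smult b (P m) + smult c (P (m - 1))"
  have deg: "degree (P k) = k" and lc: "coeff (P k) k = 1" and nz: "L (P k ^ 2) \<noteq> 0"
    if "k \<le> M" for k
    using P that by (auto simp: monic_orthogonal_seq_def orthogonal_seq_def)
  have orth: "L (P k * P l) = 0" if "k \<le> M" "l \<le> M" "k \<noteq> l" for k l
    using orthogonal_mult[OF P, of k "P l"] orthogonal_mult[OF P, of l "P k"] that
    by (cases "k < l") (auto simp: deg coeff_eq_0 mult.commute)
  have coeff_x: "coeff (?x * p) (Suc n) = coeff p n" for p n
    by (simp add: coeff_pCons)
  have degx: "degree (?x * P k) = Suc k" if "k \<le> M" for k
    using lc[OF that] deg[OF that] by (auto simp: degree_pCons_eq_if)
  have "degree R \<le> Suc m"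
    unfolding R_def using m
    by (intro degree_add_le degree_diff_le order.trans[OF degree_smult_le]) (auto simp only: deg degx)
  moreover have "coeff R (Suc m) = 0"
    unfolding R_def using m lc[of m] lc[of "Suc m"]
    by (simp add: coeff_eq_0 deg)
  ultimately have degR: "degree R \<le> m"
    by (metis degree_0 le_Suc_eq leading_coeff_0_iff zero_le)
  have "R = 0"
  proof (rule orthogonal_nondegenerate[OF P])
    show "degree R \<le> M"
      using degR m by simp
    fix k assume "k \<le> degree R"
    then have k: "k \<le> m"
      using degR by simp
    \<comment> \<open>Multiplication by \<open>x\<close> is symmetric for the bilinear form, so it
      can be moved to the factor of lower degree.\<close>
    have Lx: "L (P k * (?x * P m)) = L (P m * (?x * P k))"
      by (simp add: mult.commute)
    have LR: "L (P k * R) = L (P k * P (m + 1)) - L (P k * (?x * P m))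
                + b * L (P k * P m) + c * L (P k * P (m - 1))"
      by (simp only: R_def distrib_left right_diff_distrib add diff mult_smult_right smult)
    \<comment> \<open>The value of \<open>b\<close> settles \<open>k = m\<close> and that of
      \<open>c\<close> settles \<open>k = m - 1\<close>; below that, \<open>x * P k\<close> has
      degree less than \<open>m\<close> and every term vanishes.\<close>
    consider "k = m" | "k = m - 1" "k \<noteq> m" | "Suc k < m"
      using k by linarith
    then show "L (P k * R) = 0"
    proof cases
      case 1
      have "L (P m * P m) \<noteq> 0"
        using nz[of m] m by (simp add: power2_eq_square)
      then show ?thesis
        unfolding LR b_def using 1 m orth[of m "m + 1"] orth[of m "m - 1"]
        by (simp add: power2_eq_square del: mult_pCons_left mult_pCons_right)
    next
      case 2
      then have km: "Suc k = m"
        using m by simp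
      have "L (P m * (?x * P k)) = coeff (?x * P k) m * L (P m ^ 2)"
        using m km degx[of k] by (intro orthogonal_mult[OF P]) auto
      also have "coeff (?x * P k) m = 1"
        using coeff_x[of "P k" k] km m lc[of k] by simp
      finally have "L (P k * (?x * P m)) = L (P m ^ 2)"
        by (simp only: Lx) simp
      moreover have "c * L (P k * P (m - 1)) = L (P m ^ 2)"
        using nz[of k] km m by (auto simp: c_def subdiag_coeff_def power2_eq_square)
      ultimately show ?thesis
        unfolding LR using m km orth[of k "m + 1"] orth[of k m] by simp
    next
      case 3
      have "L (P m * (?x * P k)) = coeff (?x * P k) m * L (P m ^ 2)"
        using m 3 degx[of k] by (intro orthogonal_mult[OF P]) auto
      also have "coeff (?x * P k) m = 0"
        using degx[of k] 3 m by (intro coeff_eq_0) auto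
      finally have "L (P k * (?x * P m)) = 0"
        by (simp only: Lx) simp
      then show ?thesis
        unfolding LR using m 3 orth[of k "m + 1"] orth[of k m] orth[of k "m - 1"] by simp
    qed
  qed
  then have "P (m + 1) = ?x * P m - smult b (P m) - smult c (P (m - 1))"
    unfolding R_def by (simp add: algebra_simps eq_neg_iff_add_eq_0 add_eq_0_iff)
  also have "?x * P m - smult b (P m) = [:- b, 1:] * P m"
    by simp
  finally show ?thesis
    by (simp only: b_def c_def)
qed

section \<open>Existence by Gram--Schmidt\<close>

lemma monic_orthogonal_seq_exists:
  assumes "\<And>n. n \<le> Suc M \<Longrightarrow> det (mat n n (\<lambda>(i, j). L (monom 1 (i + j)))) \<noteq> 0"
  shows "\<exists>P. monic_orthogonal_seq L M P"
  using assms
proof (induction M)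
  case 0
  have "L 1 \<noteq> 0"
    using "0.prems"[of 1] by (simp add: det_single)
  then have "monic_orthogonal_seq L 0 (\<lambda>_. 1)"
    by (simp add: monic_orthogonal_seq_def orthogonal_seq_def)
  then show ?case by blast
next
  case (Suc M)
  then obtain P where P: "monic_orthogonal_seq L M P"
    by (metis le_SucI)
  have deg: "degree (P k) = k" and lc: "coeff (P k) k = 1" and nz: "L (P k ^ 2) \<noteq> 0"
    if "k \<le> M" for k
    using P that by (auto simp: monic_orthogonal_seq_def orthogonal_seq_def)
  have orth: "L (P k * P l) = 0" if "k \<le> M" "l \<le> M" "k \<noteq> l" for k l
    using orthogonal_mult[OF P, of k "P l"] orthogonal_mult[OF P, of l "P k"] that
    by (cases "k < l") (auto simp: deg coeff_eq_0 mult.commute)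
  \<comment> \<open>\<open>S\<close> is the orthogonal projection of \<open>x^(M+1)\<close> onto the
    span of \<open>P 0\<close>, ..., \<open>P M\<close>; the norms in the denominators are nonzero
    by induction.\<close>
  define S where
    "S = (\<Sum>k\<le>M. smult (L (monom 1 (Suc M) * P k) / L (P k ^ 2)) (P k))"
  define p where "p = monom 1 (Suc M) - S"
  define Q where "Q = P(Suc M := p)"
  have degS: "degree S < Suc M"
    unfolding S_def less_Suc_eq_le
    by (intro degree_sum_le order.trans[OF degree_smult_le]) (auto simp: deg)
  have degp: "degree p \<le> Suc M"
    unfolding p_def using degS by (intro degree_diff_le) (auto simp: degree_monom_eq)
  have cp: "coeff p (Suc M) = 1"
    using degS by (simp add: p_def coeff_eq_0)
  have degp: "degree p = Suc M"
    using degp cp by (metis le_antisym le_degree zero_neq_one)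
  have orthp: "L (p * P j) = 0" if "j \<le> M" for j
  proof -
    have "L (S * P j) = (\<Sum>k\<le>M. L (monom 1 (Suc M) * P k) / L (P k ^ 2) * L (P k * P j))"
      by (simp add: S_def sum_distrib_right sum smult)
    also have "\<dots> = (\<Sum>k\<le>M. if k = j then L (monom 1 (Suc M) * P j) else 0)"
      using that orth nz by (intro sum.cong) (auto simp: power2_eq_square)
    also have "\<dots> = L (monom 1 (Suc M) * P j)"
      using that by simp
    finally show ?thesis
      by (simp add: p_def left_diff_distrib diff)
  qed
  have degQ: "degree (Q n) = n" and lcQ: "lead_coeff (Q n) = 1" if "n \<le> Suc M" for n
    using that deg lc degp cp by (auto simp: Q_def)
  have orthQ: "L (Q n * Q m) = 0" if "n \<le> Suc M" "m < n" for n m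
    using that orth orthp by (auto simp: Q_def)
  \<comment> \<open>The construction gives orthogonality only. That the new squared norm is nonzero
    comes from the largest Hankel determinant, whose factors must all be nonzero.\<close>
  have "(\<Prod>i<Suc (Suc M). L (Q i ^ 2)) \<noteq> 0"
    using Suc.prems[of "Suc (Suc M)"] det_hankel_eq_prod[of "Suc (Suc M)" Q] degQ lcQ orthQ
    by (simp add: less_Suc_eq_le)
  then have "L (Q n ^ 2) \<noteq> 0" if "n \<le> Suc M" for n
    using that by (auto simp del: prod.lessThan_Suc)
  moreover have "Q n \<noteq> 0" if "n \<le> Suc M" for n
    using lcQ[OF that] by auto
  ultimately have "monic_orthogonal_seq L (Suc M) Q"
    using degQ lcQ orthQ by (simp add: monic_orthogonal_seq_def orthogonal_seq_def)
  then show ?case by blast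
qed

end

section \<open>The moment functional and its Hankel matrices\<close>

lemma poly_functional_moment_fun: "poly_functional (moment_fun \<mu>)"
  by unfold_locales
     (simp_all add: moment_fun_def distrib_right sum.distrib sum_distrib_left mult.assoc)

lemma moment_fun_monom: "k < dim_vec \<mu> \<Longrightarrow> moment_fun \<mu> (monom 1 k) = \<mu> $ k"
  by (simp add: moment_fun_def if_distrib[of "\<lambda>x. x * _"] cong: if_cong)

text \<open>Size \<open>n\<close> corresponds to index \<open>n - 1\<close>. The assumption says
  that the largest moment index in the matrix, \<open>2 * n - 2\<close>, lies within
  \<open>\<mu>\<close>.\<close>

lemma hankel_det_moment_fun:
  assumes "2 * n \<le> Suc (dim_vec \<mu>)"
  shows "hankel_det \<mu> (int n - 1) = det (mat n n (\<lambda>(i, j). moment_fun \<mu> (monom 1 (i + j))))"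
proof -
  have "mat n n (\<lambda>(i, j). moment_fun \<mu> (monom 1 (i + j))) = mat n n (\<lambda>(i, j). \<mu> $ (i + j))"
    using assms by (intro eq_matI) (auto simp: moment_fun_monom)
  moreover have "hankel_det \<mu> (int n - 1) = det (mat n n (\<lambda>(i, j). \<mu> $ (i + j)))"
    by (cases n) (simp_all add: hankel_det_def)
  ultimately show ?thesis
    by simp
qed

section \<open>Linearity of D and S, and the kernel of the moment matrix\<close>

text \<open>A polynomial is determined by its values on the infinite image of \<open>U\<close>. This
  replaces the \<open>THE\<close> in the definition by a characterisation through values, from which
  linearity follows.\<close>

lemma diff_op_unique:
  assumes "admissible h U X"
    and "\<And>s. s \<in> U \<Longrightarrow> poly q (X s) =
           (poly p (fwd h X s) - poly p (bwd h X s)) / (fwd h X s - bwd h X s)"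
  shows "diff_op h U X p = q"
proof (rule poly_eq_on_lattice[of X U])
  show "infinite (X ` U)"
    using assms(1) by (simp add: admissible_def)
  show "\<forall>s\<in>U. poly (diff_op h U X p) (X s) = poly q (X s)"
    by (intro ballI) (rule trans[OF poly_diff_op[OF assms(1)] assms(2)[symmetric]])
qed

lemma avg_op_unique:
  assumes "admissible h U X"
    and "\<And>s. s \<in> U \<Longrightarrow> poly q (X s) = (poly p (fwd h X s) + poly p (bwd h X s)) / 2"
  shows "avg_op h U X p = q"
proof (rule poly_eq_on_lattice[of X U])
  show "infinite (X ` U)"
    using assms(1) by (simp add: admissible_def)
  show "\<forall>s\<in>U. poly (avg_op h U X p) (X s) = poly q (X s)"
    by (intro ballI) (rule trans[OF poly_avg_op[OF assms(1)] assms(2)[symmetric]])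
qed

lemma diff_op_monom_sum:
  assumes "admissible h U X" "degree p < n"
  shows "diff_op h U X p = (\<Sum>k<n. smult (coeff p k) (diff_op h U X (monom 1 k)))"
proof (rule diff_op_unique[OF assms(1)])
  fix s assume s: "s \<in> U"
  have "poly p y = (\<Sum>k<n. coeff p k * y ^ k)" for y
    unfolding poly_altdef
    by (rule sum.mono_neutral_left) (use assms(2) in \<open>auto simp: coeff_eq_0\<close>)
  then show "poly (\<Sum>k<n. smult (coeff p k) (diff_op h U X (monom 1 k))) (X s) =
      (poly p (fwd h X s) - poly p (bwd h X s)) / (fwd h X s - bwd h X s)"
    by (simp add: poly_sum poly_diff_op[OF assms(1) s] poly_monom sum_subtractf[symmetric]
        sum_divide_distrib right_diff_distrib)
qed

lemma avg_op_monom_sum: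
  assumes "admissible h U X" "degree p < n"
  shows "avg_op h U X p = (\<Sum>k<n. smult (coeff p k) (avg_op h U X (monom 1 k)))"
proof (rule avg_op_unique[OF assms(1)])
  fix s assume s: "s \<in> U"
  have "poly p y = (\<Sum>k<n. coeff p k * y ^ k)" for y
    unfolding poly_altdef
    by (rule sum.mono_neutral_left) (use assms(2) in \<open>auto simp: coeff_eq_0\<close>)
  then show "poly (\<Sum>k<n. smult (coeff p k) (avg_op h U X (monom 1 k))) (X s) =
      (poly p (fwd h X s) + poly p (bwd h X s)) / 2"
    by (simp add: poly_sum poly_avg_op[OF assms(1) s] poly_monom sum.distrib[symmetric]
        sum_divide_distrib distrib_left)
qed

lemma moment_matrix_kernel_iff:
  assumes adm: "admissible h U X" and \<mu>: "\<mu> \<in> carrier_vec (2 * N + 3)"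
  shows "moment_matrix h U X \<phi> \<psi> N *\<^sub>v \<mu> = 0\<^sub>v (2 * N + 2) \<longleftrightarrow>
    (\<forall>p. degree p \<le> 2 * N + 1 \<longrightarrow>
       moment_fun \<mu> (\<phi> * diff_op h U X p + \<psi> * avg_op h U X p) = 0)"
proof -
  interpret poly_functional "moment_fun \<mu>"
    by (rule poly_functional_moment_fun)
  let ?F = "\<lambda>p. \<phi> * diff_op h U X p + \<psi> * avg_op h U X p"
  \<comment> \<open>The columns of the matrix are exactly the \<open>2 * N + 3\<close> indices over
    which \<open>moment_fun\<close> sums.\<close>
  have row: "(moment_matrix h U X \<phi> \<psi> N *\<^sub>v \<mu>) $ n = moment_fun \<mu> (?F (monom 1 n))"
    if "n < 2 * N + 2" for n
    using that \<mu> by (auto simp: moment_matrix_def scalar_prod_def moment_fun_def theta_def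
        atLeast0LessThan intro!: sum.cong)
  have F: "?F p = (\<Sum>k<2 * N + 2. smult (coeff p k) (?F (monom 1 k)))"
    if "degree p \<le> 2 * N + 1" for p
  proof -
    have "degree p < 2 * N + 2"
      using that by simp
    from diff_op_monom_sum[OF adm this] avg_op_monom_sum[OF adm this] show ?thesis
      by (simp only: smult_add_right sum.distrib sum_distrib_left mult_smult_right)
  qed
  have "moment_matrix h U X \<phi> \<psi> N *\<^sub>v \<mu> = 0\<^sub>v (2 * N + 2) \<longleftrightarrow>
      (\<forall>n<2 * N + 2. moment_fun \<mu> (?F (monom 1 n)) = 0)"
    using row by (auto simp: vec_eq_iff moment_matrix_def simp del: index_mult_mat_vec)
  also have "\<dots> \<longleftrightarrow> (\<forall>p. degree p \<le> 2 * N + 1 \<longrightarrow> moment_fun \<mu> (?F p) = 0)"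
  proof (intro iffI allI impI)
    fix p :: "complex poly"
    assume "\<forall>n<2 * N + 2. moment_fun \<mu> (?F (monom 1 n)) = 0" "degree p \<le> 2 * N + 1"
    then show "moment_fun \<mu> (?F p) = 0"
      by (subst F) (simp_all only: sum smult, simp)
  next
    fix n assume "\<forall>p. degree p \<le> 2 * N + 1 \<longrightarrow> moment_fun \<mu> (?F p) = 0" "n < 2 * N + 2"
    then show "moment_fun \<mu> (?F (monom 1 n)) = 0"
      by (simp add: degree_monom_eq)
  qed
  finally show ?thesis .
qed

section \<open>Moment vectors of the functional equation and their orthogonal polynomials\<close>

theorem theorem7p1:
  fixes h :: complex and U :: "complex set" and X :: "complex \<Rightarrow> complex"
    and \<phi> \<psi> :: "complex poly" and N :: nat
  assumes "h \<noteq> 0"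
    and "half_step_invariant h U"
    and "admissible h U X"
    and "degree \<phi> \<le> 2"
    and "degree \<psi> \<le> 1"
    and "\<not> (\<phi> = 0 \<and> \<psi> = 0)"
  shows
    "moment_set h U X \<phi> \<psi> N =
       {\<mu> \<in> carrier_vec (2 * N + 3). \<mu> $ 0 = 1 \<and>
          (\<forall>p. degree p \<le> 2 * N + 1 \<longrightarrow>
             diff_fun h U X (mult_fun \<phi> (moment_fun \<mu>)) p =
             avg_fun h U X (mult_fun \<psi> (moment_fun \<mu>)) p)}
     \<and> moment_set h U X \<phi> \<psi> N =
       {\<mu> \<in> carrier_vec (2 * N + 3). \<mu> $ 0 = 1 \<and>
          (\<forall>p. degree p \<le> 2 * N + 1 \<longrightarrow>
             moment_fun \<mu> (\<phi> * diff_op h U X p + \<psi> * avg_op h U X p) = 0)}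
     \<and> (\<forall>\<mu> \<in> moment_set h U X \<phi> \<psi> N.
          ((\<exists>P. monic_orthogonal_seq (moment_fun \<mu>) (N + 1) P) \<longleftrightarrow>
             (\<forall>m \<le> N + 1. hankel_det \<mu> (int m) \<noteq> 0))
          \<and> (\<forall>P Q. monic_orthogonal_seq (moment_fun \<mu>) (N + 1) P \<longrightarrow>
                monic_orthogonal_seq (moment_fun \<mu>) (N + 1) Q \<longrightarrow>
                (\<forall>n \<le> N + 1. P n = Q n))
          \<and> (\<forall>P. monic_orthogonal_seq (moment_fun \<mu>) (N + 1) P \<longrightarrow>
                (\<forall>m \<le> N + 1. moment_fun \<mu> (P m ^ 2) =
                   hankel_det \<mu> (int m) / hankel_det \<mu> (int m - 1))
                \<and> (\<forall>m \<in> {1..N + 1}. subdiag_coeff (moment_fun \<mu>) P m =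
                   hankel_det \<mu> (int m) * hankel_det \<mu> (int m - 2) /
                     (hankel_det \<mu> (int m - 1))^2)
                \<and> (\<exists>B. \<forall>m \<in> {1..N}. P (m + 1) =
                   [:- B m, 1:] * P m - smult (subdiag_coeff (moment_fun \<mu>) P m) (P (m - 1)))))"
proof (intro conjI ballI)
  let ?E = "\<lambda>\<mu>. \<forall>p. degree p \<le> 2 * N + 1 \<longrightarrow>
      moment_fun \<mu> (\<phi> * diff_op h U X p + \<psi> * avg_op h U X p) = 0"
  \<comment> \<open>The minus sign in the dual of D turns the equality of functionals into the
    vanishing of a sum.\<close>
  have equation_iff: "diff_fun h U X (mult_fun \<phi> (moment_fun \<mu>)) p =
      avg_fun h U X (mult_fun \<psi> (moment_fun \<mu>)) p \<longleftrightarrow>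
      moment_fun \<mu> (\<phi> * diff_op h U X p + \<psi> * avg_op h U X p) = 0" for \<mu> p
    by (simp add: diff_fun_def avg_fun_def mult_fun_def
        poly_functional.add[OF poly_functional_moment_fun] neg_eq_iff_add_eq_0)
  show set_eq: "moment_set h U X \<phi> \<psi> N = {\<mu> \<in> carrier_vec (2 * N + 3). \<mu> $ 0 = 1 \<and> ?E \<mu>}"
    using moment_matrix_kernel_iff[OF assms(3)] by (auto simp: moment_set_def)
  show "moment_set h U X \<phi> \<psi> N =
       {\<mu> \<in> carrier_vec (2 * N + 3). \<mu> $ 0 = 1 \<and>
          (\<forall>p. degree p \<le> 2 * N + 1 \<longrightarrow>
             diff_fun h U X (mult_fun \<phi> (moment_fun \<mu>)) p =
             avg_fun h U X (mult_fun \<psi> (moment_fun \<mu>)) p)}"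
    unfolding set_eq equation_iff ..
next
  fix \<mu> assume "\<mu> \<in> moment_set h U X \<phi> \<psi> N"
  then have \<mu>: "dim_vec \<mu> = 2 * N + 3"
    by (auto simp: moment_set_def)
  interpret poly_functional "moment_fun \<mu>"
    by (rule poly_functional_moment_fun)
  let ?L = "moment_fun \<mu>"
  \<comment> \<open>Sizes from 0 to \<open>N + 2\<close> cover the indices from -1 to
    \<open>N + 1\<close>.\<close>
  have hankel: "hankel_det \<mu> (int n - 1) = det (mat n n (\<lambda>(i, j). ?L (monom 1 (i + j))))"
    if "n \<le> N + 2" for n
    using that \<mu> by (intro hankel_det_moment_fun) simp
  have hankel_prod: "hankel_det \<mu> (int n - 1) = (\<Prod>i<n. ?L (P i ^ 2))"
    if "monic_orthogonal_seq ?L (N + 1) P" "n \<le> N + 2" for P n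
    using hankel[of n] monic_orthogonal_seq_det[of "N + 1" P n] that by simp
  have nz: "?L (P i ^ 2) \<noteq> 0" if "monic_orthogonal_seq ?L (N + 1) P" "i \<le> N + 1" for P i
    using that by (auto simp: monic_orthogonal_seq_def orthogonal_seq_def)
  \<comment> \<open>Consecutive Hankel determinants are products differing by the single factor
    \<open>?L (P m ^ 2)\<close>.\<close>
  have norm: "?L (P m ^ 2) = hankel_det \<mu> (int m) / hankel_det \<mu> (int m - 1)"
    and hankel_nz: "hankel_det \<mu> (int m) \<noteq> 0" "hankel_det \<mu> (int m - 1) \<noteq> 0"
    if P: "monic_orthogonal_seq ?L (N + 1) P" and m: "m \<le> N + 1" for P m
  proof -
    have "hankel_det \<mu> (int m) = (\<Prod>i<Suc m. ?L (P i ^ 2))"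
      using hankel_prod[OF P, of "Suc m"] m by simp
    moreover have "hankel_det \<mu> (int m - 1) = (\<Prod>i<m. ?L (P i ^ 2))"
      using hankel_prod[OF P, of m] m by simp
    moreover have "(\<Prod>i<m. ?L (P i ^ 2)) \<noteq> 0" "?L (P m ^ 2) \<noteq> 0"
      using nz[OF P] m by auto
    ultimately show "?L (P m ^ 2) = hankel_det \<mu> (int m) / hankel_det \<mu> (int m - 1)"
      "hankel_det \<mu> (int m) \<noteq> 0" "hankel_det \<mu> (int m - 1) \<noteq> 0"
      by simp_all
  qed
  show "(\<exists>P. monic_orthogonal_seq ?L (N + 1) P) \<longleftrightarrow> (\<forall>m\<le>N + 1. hankel_det \<mu> (int m) \<noteq> 0)"
  proof
    assume "\<exists>P. monic_orthogonal_seq ?L (N + 1) P"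
    then show "\<forall>m\<le>N + 1. hankel_det \<mu> (int m) \<noteq> 0"
      using hankel_nz by blast
  next
    assume nonzero: "\<forall>m\<le>N + 1. hankel_det \<mu> (int m) \<noteq> 0"
    show "\<exists>P. monic_orthogonal_seq ?L (N + 1) P"
    proof (rule monic_orthogonal_seq_exists)
      fix n assume n: "n \<le> Suc (N + 1)"
      show "det (mat n n (\<lambda>(i, j). ?L (monom 1 (i + j)))) \<noteq> 0"
      proof (cases n)
        case (Suc m)
        then show ?thesis
          using nonzero[rule_format, of m] hankel[of n] n by simp
      qed simp
    qed
  qed
  show "\<forall>P Q. monic_orthogonal_seq ?L (N + 1) P \<longrightarrow> monic_orthogonal_seq ?L (N + 1) Q \<longrightarrow>
      (\<forall>n\<le>N + 1. P n = Q n)"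
    using monic_orthogonal_seq_unique by blast
  show "\<forall>P. monic_orthogonal_seq ?L (N + 1) P \<longrightarrow>
      (\<forall>m \<le> N + 1. ?L (P m ^ 2) = hankel_det \<mu> (int m) / hankel_det \<mu> (int m - 1))
      \<and> (\<forall>m \<in> {1..N + 1}. subdiag_coeff ?L P m =
           hankel_det \<mu> (int m) * hankel_det \<mu> (int m - 2) / (hankel_det \<mu> (int m - 1))^2)
      \<and> (\<exists>B. \<forall>m \<in> {1..N}. P (m + 1) =
           [:- B m, 1:] * P m - smult (subdiag_coeff ?L P m) (P (m - 1)))"
  proof (intro allI impI conjI ballI)
    fix P assume P: "monic_orthogonal_seq ?L (N + 1) P"
    show "?L (P m ^ 2) = hankel_det \<mu> (int m) / hankel_det \<mu> (int m - 1)" if "m \<le> N + 1" for m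
      using P that by (rule norm)
    show "subdiag_coeff ?L P m =
        hankel_det \<mu> (int m) * hankel_det \<mu> (int m - 2) / (hankel_det \<mu> (int m - 1))^2"
      if m: "m \<in> {1..N + 1}" for m
    proof -
      \<comment> \<open>With \<open>m = Suc k\<close>, the natural number \<open>m - 1\<close> is
        \<open>k\<close> and the index \<open>int m - 2\<close> is \<open>int k - 1\<close>, so the
        coefficient is a quotient of the norm formulas at \<open>m\<close> and
        \<open>k\<close>.\<close>
      obtain k where k: "m = Suc k"
        using m by (cases m) simp_all
      then show ?thesis
        using m norm[OF P, of m] norm[OF P, of k]
        by (simp add: subdiag_coeff_def power2_eq_square)
    qed
    have "\<forall>m\<in>{1..N}. P (m + 1) =
        [:- (?L (P m * ([:0, 1:] * P m)) / ?L (P m ^ 2)), 1:] * P m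
        - smult (subdiag_coeff ?L P m) (P (m - 1))"
      using monic_orthogonal_seq_recurrence[OF P] by (simp del: mult_pCons_left mult_pCons_right)
    then show "\<exists>B. \<forall>m\<in>{1..N}. P (m + 1) =
        [:- B m, 1:] * P m - smult (subdiag_coeff ?L P m) (P (m - 1))"
      by (rule exI[of _ "\<lambda>m. ?L (P m * ([:0, 1:] * P m)) / ?L (P m ^ 2)"])
  qed
qed

end
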